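(* Let $i,k\in\{1,2,3,4\}$ with $i\neq k$, and let $\alpha=i_r i_{r-1}\dots i_2$ be an admissible sequence such that $\alpha k=i_r i_{r-1}\dots i_2 k$ is also admissible. Then Herrmann's endomorphism $\gamma_{ik}$ of $D^4$ acts on the admissible element $e_{\alpha k}$ by $$\gamma_{ik}(e_{\alpha k})=e_{\alpha k i}.$$
   Context: **Lattice.** $D^4$ is the free modular lattice generated by $e_1,e_2,e_3,e_4$, with a least element $0$ and a greatest element $I$ adjoined. Join is written $+$, meet is written as juxtaposition. **Herrmann's endomorphisms.** For $\{i,j,k,l\}=\{1,2,3,4\}$ put $q_{ij}=q_{ji}=q_{kl}=q_{lk}=(e_i+e_j)(e_k+e_l)$. $\gamma_{ij}$ is the lattice endomorphism of $D^4$ with $I\mapsto q_{ij}$, $0\mapsto 0$, $e_m\mapsto e_m q_{ij}$ ($m=1,2,3,4$). **Atomic elements.** For $\{i,j,k,l\}=\{1,2,3,4\}$: $a^{ij}_0=I$ and $a^{ij}_n=e_i+e_j a^{kl}_{n-1}$ for $n\ge1$ (here $e_ja^{kl}_{n-1}=e_ja^{lk}_{n-1}$). **Admissible sequences.** An admissible sequence is a nonempty finite sequence $\alpha=i_n i_{n-1}\dots i_1$ with entries in $\{1,2,3,4\}$ and $i_p\ne i_{p+1}$ for all $p$. Two such sequences are identified if one is obtained from the other by repeatedly replacing a block $ijl$ of consecutive entries by $ikl$, where $\{i,j,k,l\}=\{1,2,3,4\}$. $i_1$ is the start, $i_n$ the end, $n$ the length. $(pq)^t$ denotes $pq$ repeated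 $t$ times (empty for $t=0$). **Admissible elements $e_\alpha$.** An admissible sequence starting at $1$ is, up to the identification, exactly one of the following, and $e_\alpha$ is defined accordingly ($r,s,t\ge0$ with the extra restriction listed): - $(21)^t(41)^r(31)^s$, $t\ge1$: $e_\alpha=e_2a^{31}_{2s}a^{41}_{2r}a^{34}_{2t-1}$; - $(31)^s(41)^r(21)^t$, $s\ge1$: $e_\alpha=e_3a^{21}_{2t}a^{41}_{2r}a^{24}_{2s-1}$; - $(41)^r(31)^s(21)^t$, $r\ge1$: $e_\alpha=e_4a^{21}_{2t}a^{31}_{2s}a^{32}_{2r-1}$; - $1(41)^r(31)^s(21)^t$: $e_\alpha=e_1a^{24}_{2s}a^{34}_{2t}a^{32}_{2r}$; - $2(41)^r(31)^s(21)^t$, $r\ge1$: $e_\alpha=e_2a^{34}_{2t}a^{31}_{2s+1}a^{14}_{2r-1}$; - $3(41)^r(21)^t(31)^s$, $r\ge1$: $e_\alpha=e_3a^{24}_{2s}a^{21}_{2t+1}a^{14}_{2r-1}$; - $4(21)^t(31)^s(41)^r$, $t\ge1$: $e_\alpha=e_4a^{32}_{2r}a^{31}_{2s+1}a^{12}_{2t-1}$; - $(14)^r(31)^s(21)^t$, $r,s\ge1$: $e_\alpha=e_1a^{23}_{2r-1}a^{24}_{2s-1}a^{34}_{2t+1}$. For a sequence $\alpha$ starting at $m\neq1$, let $\alpha'$ be the sequence starting at $1$ obtained from $\alpha$ by interchanging the entries $1$ and $m$; then $e_\alpha$ is obtained from the expression defining $e_{\alpha'}$ by interchanging the indices $1$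 and $m$ everywhere (in generators and atomic elements). *)

theory Defs
  imports "HOL-Library.Lattice_Constructions" "HOL-Combinatorics.Transposition"
begin

unbundle lattice_syntax

section \<open>Free modular lattices\<close>

class modular_lattice = lattice +
  assumes modular_law: "x \<le> z \<Longrightarrow> x \<squnion> (y \<sqinter> z) = (x \<squnion> y) \<sqinter> z"

datatype 'a lterm = Var 'a | Join "'a lterm" "'a lterm" | Meet "'a lterm" "'a lterm"

text \<open>
  The least congruence on lattice terms containing the lattice axioms and the equational form
  \<open>xz + yz = (xz + y)z\<close> of the modular law.
\<close>

inductive modular_eq :: "'a lterm \<Rightarrow> 'a lterm \<Rightarrow> bool" where
  eq_refl: "modular_eq s s"
| eq_sym: "modular_eq s t \<Longrightarrow> modular_eq t s"
| eq_trans: "modular_eq s t \<Longrightarrow> modular_eq t u \<Longrightarrow> modular_eq s u"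
| Join_cong: "modular_eq s s' \<Longrightarrow> modular_eq t t' \<Longrightarrow> modular_eq (Join s t) (Join s' t')"
| Meet_cong: "modular_eq s s' \<Longrightarrow> modular_eq t t' \<Longrightarrow> modular_eq (Meet s t) (Meet s' t')"
| Join_commute: "modular_eq (Join s t) (Join t s)"
| Meet_commute: "modular_eq (Meet s t) (Meet t s)"
| Join_assoc: "modular_eq (Join (Join s t) u) (Join s (Join t u))"
| Meet_assoc: "modular_eq (Meet (Meet s t) u) (Meet s (Meet t u))"
| Join_absorb: "modular_eq (Join s (Meet s t)) s"
| Meet_absorb: "modular_eq (Meet s (Join s t)) s"
| eq_modular: "modular_eq (Join (Meet s u) (Meet t u)) (Meet (Join (Meet s u) t) u)"

quotient_type 'a free_modular = "'a lterm" / modular_eq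
  by (rule equivpI)
    (auto intro: reflpI sympI transpI modular_eq.eq_refl modular_eq.eq_sym elim: modular_eq.eq_trans)

lift_definition free_gen :: "'a \<Rightarrow> 'a free_modular" is Var .

instantiation free_modular :: (type) modular_lattice
begin

lift_definition sup_free_modular :: "'a free_modular \<Rightarrow> 'a free_modular \<Rightarrow> 'a free_modular"
  is Join by (rule modular_eq.Join_cong)

lift_definition inf_free_modular :: "'a free_modular \<Rightarrow> 'a free_modular \<Rightarrow> 'a free_modular"
  is Meet by (rule modular_eq.Meet_cong)

definition less_eq_free_modular where
  "x \<le> y \<longleftrightarrow> x \<sqinter> y = (x :: 'a free_modular)"

definition less_free_modular where
  "x < y \<longleftrightarrow> x \<le> y \<and> \<not> y \<le> (x :: 'a free_modular)"

instance
proof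
  fix x y z :: "'a free_modular"
  have sc: "x \<squnion> y = y \<squnion> x" for x y :: "'a free_modular"
    by transfer (rule modular_eq.Join_commute)
  have ic: "x \<sqinter> y = y \<sqinter> x" for x y :: "'a free_modular"
    by transfer (rule modular_eq.Meet_commute)
  have sa: "(x \<squnion> y) \<squnion> z = x \<squnion> (y \<squnion> z)" for x y z :: "'a free_modular"
    by transfer (rule modular_eq.Join_assoc)
  have ia: "(x \<sqinter> y) \<sqinter> z = x \<sqinter> (y \<sqinter> z)" for x y z :: "'a free_modular"
    by transfer (rule modular_eq.Meet_assoc)
  have sab: "x \<squnion> (x \<sqinter> y) = x" for x y :: "'a free_modular"
    by transfer (rule modular_eq.Join_absorb)
  have iab: "x \<sqinter> (x \<squnion> y) = x" for x y :: "'a free_modular"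
    by transfer (rule modular_eq.Meet_absorb)
  have md: "(x \<sqinter> z) \<squnion> (y \<sqinter> z) = ((x \<sqinter> z) \<squnion> y) \<sqinter> z" for x y z :: "'a free_modular"
    by transfer (rule modular_eq.eq_modular)
  have ii: "x \<sqinter> x = x" for x :: "'a free_modular"
    by (metis sab iab)
  have le_sup: "x \<le> y \<longleftrightarrow> x \<squnion> y = y" for x y :: "'a free_modular"
    unfolding less_eq_free_modular_def by (metis sab iab sc ic)
  show "x < y \<longleftrightarrow> x \<le> y \<and> \<not> y \<le> x"
    by (simp add: less_free_modular_def)
  show "x \<le> x"
    by (simp add: less_eq_free_modular_def ii)
  show "x \<le> y \<Longrightarrow> y \<le> z \<Longrightarrow> x \<le> z"
    unfolding less_eq_free_modular_def by (metis ia)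
  show "x \<le> y \<Longrightarrow> y \<le> x \<Longrightarrow> x = y"
    unfolding less_eq_free_modular_def by (metis ic)
  show "x \<sqinter> y \<le> x" "x \<sqinter> y \<le> y"
    unfolding less_eq_free_modular_def by (metis ia ic ii)+
  show "x \<le> y \<Longrightarrow> x \<le> z \<Longrightarrow> x \<le> y \<sqinter> z"
    unfolding less_eq_free_modular_def by (metis ia)
  show "x \<le> x \<squnion> y"
    unfolding less_eq_free_modular_def by (rule iab)
  show "y \<le> x \<squnion> y"
    unfolding less_eq_free_modular_def by (metis iab sc)
  show "y \<le> x \<Longrightarrow> z \<le> x \<Longrightarrow> y \<squnion> z \<le> x"
    unfolding le_sup by (metis sa)
  show "x \<le> z \<Longrightarrow> x \<squnion> (y \<sqinter> z) = (x \<squnion> y) \<sqinter> z"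
    using md[of x z y] unfolding less_eq_free_modular_def by simp
qed

end

definition lattice_hom :: "('a::lattice \<Rightarrow> 'b::lattice) \<Rightarrow> bool" where
  "lattice_hom f \<longleftrightarrow> (\<forall>x y. f (x \<squnion> y) = f x \<squnion> f y \<and> f (x \<sqinter> y) = f x \<sqinter> f y)"

lemma free_modular_induct [case_names gen sup inf]:
  assumes "\<And>a. P (free_gen a)"
    and "\<And>x y. P x \<Longrightarrow> P y \<Longrightarrow> P (x \<squnion> y)"
    and "\<And>x y. P x \<Longrightarrow> P y \<Longrightarrow> P (x \<sqinter> y)"
  shows "P x"
proof -
  have "P (abs_free_modular t)" for t
    by (induction t)
      (use assms in \<open>simp_all add: free_gen.abs_eq sup_free_modular.abs_eq[symmetric]
        inf_free_modular.abs_eq[symmetric] free_gen_def\<close>)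
  then show ?thesis
    by (metis Quotient3_abs_rep Quotient3_free_modular)
qed

primrec term_value :: "('a \<Rightarrow> 'b::lattice) \<Rightarrow> 'a lterm \<Rightarrow> 'b" where
  "term_value g (Var a) = g a"
| "term_value g (Join s t) = term_value g s \<squnion> term_value g t"
| "term_value g (Meet s t) = term_value g s \<sqinter> term_value g t"

lift_definition free_ext :: "('a \<Rightarrow> 'b::modular_lattice) \<Rightarrow> 'a free_modular \<Rightarrow> 'b" is term_value
proof -
  fix g :: "'a \<Rightarrow> 'b" and s t :: "'a lterm"
  assume "modular_eq s t"
  then show "term_value g s = term_value g t"
    by induction (simp_all add: modular_law, simp_all add: ac_simps)
qed

lemma free_ext_gen: "free_ext g (free_gen a) = g a"
  by transfer simp

lemma lattice_hom_free_ext: "lattice_hom (free_ext g)"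
  unfolding lattice_hom_def by (intro allI conjI; transfer; simp)

lemma free_modular_universal:
  fixes g :: "'a \<Rightarrow> 'b::modular_lattice"
  shows "\<exists>!f. lattice_hom f \<and> (\<forall>a. f (free_gen a) = g a)"
proof (rule ex1I[of _ "free_ext g"])
  show "lattice_hom (free_ext g) \<and> (\<forall>a. free_ext g (free_gen a) = g a)"
    by (simp add: lattice_hom_free_ext free_ext_gen)
next
  fix f assume f: "lattice_hom f \<and> (\<forall>a. f (free_gen a) = g a)"
  show "f = free_ext g"
  proof
    fix x show "f x = free_ext g x"
      by (induction x rule: free_modular_induct)
        (use f lattice_hom_free_ext[of g] in \<open>auto simp: lattice_hom_def free_ext_gen\<close>)
  qed
qed

section \<open>The lattice \<open>D\<^sup>4\<close>\<close>

datatype index = N1 | N2 | N3 | N4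

instance bot :: (modular_lattice) modular_lattice
proof
  fix x y z :: "'a bot"
  show "x \<le> z \<Longrightarrow> x \<squnion> (y \<sqinter> z) = (x \<squnion> y) \<sqinter> z"
    by (cases x; cases y; cases z)
      (auto simp: sup_bot_def inf_bot_def modular_law sup.absorb1 inf.absorb1)
qed

instance top :: (modular_lattice) modular_lattice
proof
  fix x y z :: "'a top"
  show "x \<le> z \<Longrightarrow> x \<squnion> (y \<sqinter> z) = (x \<squnion> y) \<sqinter> z"
    by (cases x; cases y; cases z)
      (auto simp: sup_top_def inf_top_def modular_law sup.absorb2 inf.absorb1)
qed

instance top :: (bounded_lattice_bot) bounded_lattice
  by standard (auto simp: bot_top_def less_eq_top_def split: top.splits)

text \<open>
  Both bounds are new: even the join and the meet of all four generators differ from them.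
\<close>

type_synonym D4 = "index free_modular bot top"

definition gen :: "index \<Rightarrow> D4" where
  "gen m = top.Value (bot.Value (free_gen m))"

text \<open>The two indices other than \<open>i\<close> and \<open>j\<close>; only meaningful for \<open>i \<noteq> j\<close>.\<close>

definition other_pair :: "index \<Rightarrow> index \<Rightarrow> index \<times> index" where
  "other_pair i j = (case filter (\<lambda>m. m \<noteq> i \<and> m \<noteq> j) [N1, N2, N3, N4] of
     [k, l] \<Rightarrow> (k, l) | _ \<Rightarrow> undefined)"

lemma other_pair:
  assumes "distinct [i, j, k, l]"
  shows "other_pair i j = (k, l) \<or> other_pair i j = (l, k)"
  using assms by (cases i; cases j; cases k; cases l) (simp_all add: other_pair_def)

definition q_elem :: "index \<Rightarrow> index \<Rightarrow> D4" where
  "q_elem i j = (case other_pair i j of (k, l) \<Rightarrow> (gen i \<squnion> gen j) \<sqinter> (gen k \<squnion> gen l))"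

lemma q_elem_eq: "distinct [i, j, k, l] \<Longrightarrow> q_elem i j = (gen i \<squnion> gen j) \<sqinter> (gen k \<squnion> gen l)"
  using other_pair[of i j k l] by (auto simp: q_elem_def sup.commute)

section \<open>Herrmann's endomorphisms\<close>

definition herrmann :: "index \<Rightarrow> index \<Rightarrow> D4 \<Rightarrow> D4" where
  "herrmann i j = (THE f. lattice_hom f \<and> f \<top> = q_elem i j \<and> f \<bottom> = \<bottom> \<and>
     (\<forall>m. f (gen m) = gen m \<sqinter> q_elem i j))"

lemma herrmann_ex1:
  fixes p :: D4
  shows "\<exists>!f. lattice_hom f \<and> f \<top> = p \<and> f \<bottom> = \<bottom> \<and> (\<forall>m. f (gen m) = gen m \<sqinter> p)"
proof -
  define g where "g = free_ext (\<lambda>m. gen m \<sqinter> p)"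
  define F where "F x = (case x of top.Top \<Rightarrow> p
    | top.Value y \<Rightarrow> (case y of bot.Bot \<Rightarrow> \<bottom> | bot.Value v \<Rightarrow> g v))" for x :: D4
  have hom: "g (x \<squnion> y) = g x \<squnion> g y" "g (x \<sqinter> y) = g x \<sqinter> g y" for x y
    using lattice_hom_free_ext[of "\<lambda>m. gen m \<sqinter> p"] by (simp_all add: lattice_hom_def g_def)
  have le: "g x \<le> p" for x
    by (induction x rule: free_modular_induct)
      (simp_all add: hom le_infI1, simp add: g_def free_ext_gen)
  show ?thesis
  proof (rule ex1I[of _ F])
    have F: "F \<top> = p" "F \<bottom> = \<bottom>" "F (top.Value (bot.Value v)) = g v" for v
      by (simp_all add: F_def top_top_def bot_top_def bot_bot_def)
    have ex: "x = \<top> \<or> x = \<bottom> \<or> (\<exists>v. x = top.Value (bot.Value v))" for x :: D4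
      by (metis bot.exhaust bot_bot_def bot_top_def top.exhaust top_top_def)
    have emb: "top.Value (bot.Value v) \<squnion> top.Value (bot.Value w) = top.Value (bot.Value (v \<squnion> w))"
      "top.Value (bot.Value v) \<sqinter> top.Value (bot.Value w) = top.Value (bot.Value (v \<sqinter> w))"
      for v w :: "index free_modular"
      by (simp_all add: sup_top_def sup_bot_def inf_top_def inf_bot_def)
    have "F (x \<squnion> y) = F x \<squnion> F y \<and> F (x \<sqinter> y) = F x \<sqinter> F y" for x y
      using ex[of x] ex[of y]
      by (elim disjE exE) (simp_all add: F emb hom le sup.absorb1 sup.absorb2 inf.absorb1 inf.absorb2)
    then show "lattice_hom F \<and> F \<top> = p \<and> F \<bottom> = \<bottom> \<and> (\<forall>m. F (gen m) = gen m \<sqinter> p)"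
      by (auto simp: lattice_hom_def F_def top_top_def bot_top_def bot_bot_def gen_def
          g_def free_ext_gen)
  next
    fix f assume f: "lattice_hom f \<and> f \<top> = p \<and> f \<bottom> = \<bottom> \<and> (\<forall>m. f (gen m) = gen m \<sqinter> p)"
    have val: "f (top.Value (bot.Value v)) = g v" for v
    proof (induction v rule: free_modular_induct)
      case (gen a)
      then show ?case using f by (simp add: gen_def g_def free_ext_gen)
    next
      case (sup x y)
      have "top.Value (bot.Value (x \<squnion> y)) =
          top.Value (bot.Value x) \<squnion> top.Value (bot.Value y)"
        by (simp add: sup_top_def sup_bot_def)
      then show ?case using f sup by (simp add: lattice_hom_def hom)
    next
      case (inf x y)
      have "top.Value (bot.Value (x \<sqinter> y)) =
          top.Value (bot.Value x) \<sqinter> top.Value (bot.Value y)"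
        by (simp add: inf_top_def inf_bot_def)
      then show ?case using f inf by (simp add: lattice_hom_def hom)
    qed
    show "f = F"
    proof
      fix x show "f x = F x"
        using f val by (auto simp: F_def top_top_def bot_top_def bot_bot_def
            split: top.splits bot.splits)
    qed
  qed
qed

lemma herrmann:
  "lattice_hom (herrmann i j)" "herrmann i j \<top> = q_elem i j" "herrmann i j \<bottom> = \<bottom>"
  "herrmann i j (gen m) = gen m \<sqinter> q_elem i j"
  using theI'[OF herrmann_ex1[of "q_elem i j"]] unfolding herrmann_def by blast+

section \<open>Atomic elements\<close>

primrec atomic :: "nat \<Rightarrow> index \<Rightarrow> index \<Rightarrow> D4" where
  "atomic 0 = (\<lambda>i j. \<top>)"
| "atomic (Suc n) = (\<lambda>i j. case other_pair i j of (k, l) \<Rightarrow> gen i \<squnion> gen j \<sqinter> atomic n k l)"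

abbreviation atom :: "index \<Rightarrow> index \<Rightarrow> nat \<Rightarrow> D4" where
  "atom i j n \<equiv> atomic n i j"

text \<open>The order of the complementary pair is immaterial.\<close>

lemma
  assumes "distinct [i, j, k, l]"
  shows atom_swap: "gen j \<sqinter> atom k l n = gen j \<sqinter> atom l k n"
    and atom_Suc: "atom i j (Suc n) = gen i \<squnion> gen j \<sqinter> atom k l n"
proof -
  have "\<forall>i j k l. distinct [i, j, k, l] \<longrightarrow>
      gen j \<sqinter> atom k l n = gen j \<sqinter> atom l k n \<and> atom i j (Suc n) = gen i \<squnion> gen j \<sqinter> atom k l n" for n
  proof (induction n)
    case 0
    show ?case using other_pair by fastforce
  next
    case (Suc n)
    have swap: "gen j \<sqinter> atom k l (Suc n) = gen j \<sqinter> atom l k (Suc n)" if d: "distinct [i, j, k, l]" for i j k l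
    proof -
      have A: "atom k l (Suc n) = gen k \<squnion> gen l \<sqinter> atom i j n" "atom l k (Suc n) = gen l \<squnion> gen k \<sqinter> atom i j n"
        using Suc.IH[rule_format, of k l i j] Suc.IH[rule_format, of l k j i]
          Suc.IH[rule_format, of l k i j] d by auto
      have B: "gen l \<sqinter> atom i j n = gen l \<sqinter> atom j i n" "gen k \<sqinter> atom i j n = gen k \<sqinter> atom j i n"
        using Suc.IH[rule_format, of k l i j] Suc.IH[rule_format, of l k i j] d by auto
      show ?thesis
      proof (cases n)
        case 0
        then show ?thesis using A by (simp add: sup.commute)
      next
        case (Suc m)
        define w where "w = atom j i n"
        have "gen j \<le> w"
          by (simp add: w_def Suc split: prod.split)
        then have jw: "gen j \<sqinter> w = gen j" by (simp add: inf.absorb1)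
        have modw: "w \<sqinter> (x \<squnion> y \<sqinter> w) = (x \<sqinter> w) \<squnion> (y \<sqinter> w)" for x y
          using modular_law[of "y \<sqinter> w" w x] by (simp add: inf.commute sup.commute)
        have C: "gen j \<sqinter> (x \<squnion> y \<sqinter> w) = gen j \<sqinter> ((x \<sqinter> w) \<squnion> (y \<sqinter> w))" for x y
          using arg_cong[OF modw[of x y], of "\<lambda>u. gen j \<sqinter> u"]
          by (simp only: inf.assoc[symmetric] jw)
        have "gen j \<sqinter> (gen k \<squnion> gen l \<sqinter> w) = gen j \<sqinter> (gen l \<squnion> gen k \<sqinter> w)"
          using C[of "gen k" "gen l"] C[of "gen l" "gen k"] by (metis sup.commute)
        then show ?thesis by (simp only: A B w_def)
      qed
    qed
    have "atom i j (Suc (Suc n)) = gen i \<squnion> gen j \<sqinter> atom k l (Suc n)" if d: "distinct [i, j, k, l]" for i j k l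
    proof -
      obtain k' l' where o: "other_pair i j = (k', l')" "k' = k \<and> l' = l \<or> k' = l \<and> l' = k"
        using other_pair[OF d] by blast
      have "atom i j (Suc (Suc n)) = gen i \<squnion> gen j \<sqinter> atom k' l' (Suc n)"
        by (simp only: atomic.simps(2)[of "Suc n"] o prod.case)
      with o(2) swap[OF d] show ?thesis by metis
    qed
    with swap show ?case by blast
  qed
  with assms show "gen j \<sqinter> atom k l n = gen j \<sqinter> atom l k n" "atom i j (Suc n) = gen i \<squnion> gen j \<sqinter> atom k l n"
    by blast+
qed

section \<open>Admissible sequences and admissible elements\<close>

text \<open>
  The sequence \<open>i\<^sub>n \<dots> i\<^sub>1\<close> is the list \<open>[i\<^sub>n, \<dots>, i\<^sub>1]\<close>, so that its start \<open>i\<^sub>1\<close> is the last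
  entry of the list.
\<close>

definition admissible :: "index list \<Rightarrow> bool" where
  "admissible \<alpha> \<longleftrightarrow> \<alpha> \<noteq> [] \<and> distinct_adj \<alpha>"

inductive seq_step :: "index list \<Rightarrow> index list \<Rightarrow> bool" where
  "distinct [i, j, k, l] \<Longrightarrow> seq_step (\<beta> @ [i, j, l] @ \<delta>) (\<beta> @ [i, k, l] @ \<delta>)"

abbreviation seq_eq :: "index list \<Rightarrow> index list \<Rightarrow> bool" where
  "seq_eq \<equiv> seq_step\<^sup>*\<^sup>*"

abbreviation rep :: "index list \<Rightarrow> nat \<Rightarrow> index list" where
  "rep \<beta> t \<equiv> concat (replicate t \<beta>)"

text \<open>
  \<open>adm_form \<sigma> \<beta> x\<close>: \<open>\<beta>\<close> is one of the listed sequences starting at 1, and \<open>x\<close> is the value of the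
  expression attached to \<open>\<beta>\<close> after the index substitution \<open>\<sigma>\<close>.
\<close>

inductive adm_form :: "(index \<Rightarrow> index) \<Rightarrow> index list \<Rightarrow> D4 \<Rightarrow> bool" for \<sigma> :: "index \<Rightarrow> index" where
  "t \<ge> 1 \<Longrightarrow> adm_form \<sigma> (rep [N2, N1] t @ rep [N4, N1] r @ rep [N3, N1] s)
     (gen (\<sigma> N2) \<sqinter> atom (\<sigma> N3) (\<sigma> N1) (2 * s) \<sqinter> atom (\<sigma> N4) (\<sigma> N1) (2 * r) \<sqinter> atom (\<sigma> N3) (\<sigma> N4) (2 * t - 1))"
| "s \<ge> 1 \<Longrightarrow> adm_form \<sigma> (rep [N3, N1] s @ rep [N4, N1] r @ rep [N2, N1] t)
     (gen (\<sigma> N3) \<sqinter> atom (\<sigma> N2) (\<sigma> N1) (2 * t) \<sqinter> atom (\<sigma> N4) (\<sigma> N1) (2 * r) \<sqinter> atom (\<sigma> N2) (\<sigma> N4) (2 * s - 1))"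
| "r \<ge> 1 \<Longrightarrow> adm_form \<sigma> (rep [N4, N1] r @ rep [N3, N1] s @ rep [N2, N1] t)
     (gen (\<sigma> N4) \<sqinter> atom (\<sigma> N2) (\<sigma> N1) (2 * t) \<sqinter> atom (\<sigma> N3) (\<sigma> N1) (2 * s) \<sqinter> atom (\<sigma> N3) (\<sigma> N2) (2 * r - 1))"
| "adm_form \<sigma> ([N1] @ rep [N4, N1] r @ rep [N3, N1] s @ rep [N2, N1] t)
     (gen (\<sigma> N1) \<sqinter> atom (\<sigma> N2) (\<sigma> N4) (2 * s) \<sqinter> atom (\<sigma> N3) (\<sigma> N4) (2 * t) \<sqinter> atom (\<sigma> N3) (\<sigma> N2) (2 * r))"
| "r \<ge> 1 \<Longrightarrow> adm_form \<sigma> ([N2] @ rep [N4, N1] r @ rep [N3, N1] s @ rep [N2, N1] t)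
     (gen (\<sigma> N2) \<sqinter> atom (\<sigma> N3) (\<sigma> N4) (2 * t) \<sqinter> atom (\<sigma> N3) (\<sigma> N1) (2 * s + 1) \<sqinter> atom (\<sigma> N1) (\<sigma> N4) (2 * r - 1))"
| "r \<ge> 1 \<Longrightarrow> adm_form \<sigma> ([N3] @ rep [N4, N1] r @ rep [N2, N1] t @ rep [N3, N1] s)
     (gen (\<sigma> N3) \<sqinter> atom (\<sigma> N2) (\<sigma> N4) (2 * s) \<sqinter> atom (\<sigma> N2) (\<sigma> N1) (2 * t + 1) \<sqinter> atom (\<sigma> N1) (\<sigma> N4) (2 * r - 1))"
| "t \<ge> 1 \<Longrightarrow> adm_form \<sigma> ([N4] @ rep [N2, N1] t @ rep [N3, N1] s @ rep [N4, N1] r)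
     (gen (\<sigma> N4) \<sqinter> atom (\<sigma> N3) (\<sigma> N2) (2 * r) \<sqinter> atom (\<sigma> N3) (\<sigma> N1) (2 * s + 1) \<sqinter> atom (\<sigma> N1) (\<sigma> N2) (2 * t - 1))"
| "r \<ge> 1 \<Longrightarrow> s \<ge> 1 \<Longrightarrow> adm_form \<sigma> (rep [N1, N4] r @ rep [N3, N1] s @ rep [N2, N1] t)
     (gen (\<sigma> N1) \<sqinter> atom (\<sigma> N2) (\<sigma> N3) (2 * r - 1) \<sqinter> atom (\<sigma> N2) (\<sigma> N4) (2 * s - 1) \<sqinter> atom (\<sigma> N3) (\<sigma> N4) (2 * t + 1))"

text \<open>
  For a sequence starting at \<open>m\<close>, \<open>\<tau>\<close> interchanges 1 and \<open>m\<close>; it is the identity if \<open>m\<close> is 1.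
  The element is determined because every admissible sequence starting at 1 is identified with
  exactly one listed sequence, for exactly one choice of the line and of the parameters.
\<close>

definition adm_elem :: "index list \<Rightarrow> D4" where
  "adm_elem \<alpha> = (let \<tau> = Transposition.transpose N1 (last \<alpha>) in
     THE x. \<exists>\<beta>. seq_eq (map \<tau> \<alpha>) \<beta> \<and> adm_form \<tau> \<beta> x)"

end

theory Submission
  imports Defs "HOL-Library.Multiset"
begin

text \<open>
  Label every pair of consecutive entries \<open>x y\<close> of an admissible sequence by the partition
  \<open>{{x, y}, {z, w}}\<close> of the four indices, one of three possible \<^emph>\<open>pairings\<close>. Given an entry and
  a pairing, the neighbouring entry is determined, so a sequence amounts to its start together with
  the word of its labels. The block \<open>ijl\<close> has two different labels, and replacing it by \<open>ikl\<close>
  exchanges them. Hence the identification of sequences lets distinct labels commute: two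
  admissible sequences are identified iff they have the same start and each pairing occurs equally
  often in both (\<open>seq_eq_invariants\<close>, \<open>seq_eq_if_same_steps\<close>).

  Read in these terms, the eight expressions for \<open>e\<^sub>\<alpha>\<close> are one. The sequence ends in some \<open>i\<close>; each
  pairing has exactly one block \<open>{k, l}\<close> that avoids \<open>i\<close>, and \<open>e\<^sub>\<alpha>\<close> is the meet of \<open>e\<^sub>i\<close> with the
  three atomic elements \<open>a\<^sup>k\<^sup>l\<^sub>n\<close>, where \<open>n\<close> is the number of occurrences of the pairing in \<open>\<alpha>\<close>
  (\<open>adm_elem_eq_class_elem\<close>). This description is invariant under permutations of the indices, so it
  is the same for every start.

  Passing from \<open>\<alpha>k\<close> to \<open>\<alpha>ki\<close> keeps the end and adds one occurrence of the pairing of \<open>i\<close> and \<open>k\<close>.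
  Herrmann's endomorphism depends only on that pairing as well. The modular law shows that it maps
  \<open>a\<^sup>k\<^sup>l\<^sub>n\<close> to \<open>q a\<^sup>k\<^sup>l\<^sub>n\<^sub>+\<^sub>1\<close> if \<open>{k, l}\<close> is a block of its pairing, and to \<open>q a\<^sup>k\<^sup>l\<^sub>n\<close> otherwise
  (\<open>herrmann_atom_along\<close>, \<open>herrmann_atom_across\<close>). In the meet with \<open>e\<^sub>i\<close> the factor \<open>q\<close> is absorbed, and
  what remains is the expression with exactly one of the three indices raised by one.
\<close>

section \<open>Pairings\<close>

definition pairing :: "index \<Rightarrow> index \<Rightarrow> index set set" where
  "pairing i j = {{i, j}, - {i, j}}"

lemma UNIV_index:
  fixes i j k l :: index
  assumes "distinct [i, j, k, l]"
  shows "UNIV = {i, j, k, l}"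
proof -
  have "m \<in> {i, j, k, l}" for m
    using assms by (cases i; cases j; cases k; cases l; cases m; simp)
  then show ?thesis by auto
qed

lemma Compl_index:
  fixes i j k l :: index
  assumes "distinct [i, j, k, l]"
  shows "- {i, j} = {k, l}"
  using assms UNIV_index[OF assms] by auto

lemma ex_fourth_index:
  fixes i j k :: index
  assumes "distinct [i, j, k]"
  obtains l where "distinct [i, j, k, l]"
proof -
  have "\<exists>l\<in>{N1, N2, N3, N4}. distinct [i, j, k, l]"
    using assms by (cases i; cases j; cases k) simp_all
  with that show ?thesis by blast
qed

lemma ex_complementary_pair:
  fixes i j :: index
  assumes "i \<noteq> j"
  obtains k l where "distinct [i, j, k, l]"
proof -
  have "\<exists>k\<in>{N1, N2, N3, N4}. \<exists>l\<in>{N1, N2, N3, N4}. distinct [i, j, k, l]"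
    using assms by (cases i; cases j) simp_all
  with that show ?thesis by blast
qed

lemma pairing_commute: "pairing i j = pairing j i"
  by (simp add: pairing_def insert_commute)

lemma pairing_opposite: "distinct [i, j, k, l] \<Longrightarrow> pairing i j = pairing k l"
  using Compl_index[of i j k l] Compl_index[of k l i j] by (auto simp: pairing_def)

lemma pairing_eq_iff [simp]: "pairing i j = pairing i k \<longleftrightarrow> j = k"
proof
  assume "pairing i j = pairing i k"
  then have "{i, j} = {i, k} \<or> {i, j} = - {i, k}"
    by (auto simp: pairing_def)
  then show "j = k" by (auto simp: doubleton_eq_iff)
qed simp

lemma pairing_map:
  assumes "bij \<sigma>"
  shows "pairing (\<sigma> i) (\<sigma> j) = (`) \<sigma> ` pairing i j"
  unfolding pairing_def image_insert image_empty bij_image_Compl_eq[OF assms] ..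

text \<open>
  Every pairing is given by the partner that it assigns to any prescribed index \<open>m\<close>. With \<open>m\<close> the
  end of a sequence, this names the atomic factor to which the pairing belongs.
\<close>

lemma pairing_partner:
  assumes "i \<noteq> j"
  obtains n where "n \<noteq> m" "pairing i j = pairing m n"
proof -
  consider "m = i" | "m = j" | "m \<noteq> i" "m \<noteq> j" by blast
  then show ?thesis
  proof cases
    case 3
    then obtain l where "distinct [i, j, m, l]"
      using assms ex_fourth_index[of i j m] by auto
    then show ?thesis using that[of l] pairing_opposite[of i j m l] by auto
  qed (use assms that[of i] that[of j] in \<open>auto simp: pairing_commute\<close>)
qed

section \<open>Sequences up to the identification\<close>

fun steps :: "index list \<Rightarrow> index set set multiset" where
  "steps (x # y # \<alpha>) = add_mset (pairing x y) (steps (y # \<alpha>))"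
| "steps \<alpha> = {#}"

lemma steps_append: "steps (\<alpha> @ x # \<beta>) = steps (\<alpha> @ [x]) + steps (x # \<beta>)"
  by (induction \<alpha> rule: steps.induct) (auto simp: neq_Nil_conv)

lemma steps_map: "bij \<sigma> \<Longrightarrow> steps (map \<sigma> \<alpha>) = image_mset ((`) ((`) \<sigma>)) (steps \<alpha>)"
  by (induction \<alpha> rule: steps.induct) (simp_all add: pairing_map)

text \<open>
  The multiset of labels is invariant because the blocks \<open>ijl\<close> and \<open>ikl\<close> carry the same two labels
  in opposite order: \<open>i, j\<close> and \<open>k, l\<close> belong to one pairing, \<open>j, l\<close> and \<open>i, k\<close> to another.
\<close>

lemma seq_step_invariants:
  assumes "seq_step \<alpha> \<beta>"
  shows "steps \<alpha> = steps \<beta>" "hd \<alpha> = hd \<beta>" "last \<alpha> = last \<beta>" "distinct_adj \<alpha> = distinct_adj \<beta>"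
    "length \<alpha> = length \<beta>"
proof -
  show "steps \<alpha> = steps \<beta>"
    using assms
  proof cases
    case (1 i j k l \<gamma> \<delta>)
    then have "pairing i j = pairing k l" "pairing j l = pairing i k"
      using pairing_opposite[of i j k l] pairing_opposite[of j l i k] by auto
    then show ?thesis
      using 1 steps_append[of \<gamma> i "j # l # \<delta>"] steps_append[of \<gamma> i "k # l # \<delta>"] by simp
  qed
  show "hd \<alpha> = hd \<beta>" "last \<alpha> = last \<beta>" "length \<alpha> = length \<beta>"
    using assms by (cases; simp add: hd_append)+
  show "distinct_adj \<alpha> = distinct_adj \<beta>"
    using assms by cases (auto simp: distinct_adj_append_iff)
qed

lemma seq_eq_invariants:
  assumes "seq_eq \<alpha> \<beta>"
  shows "steps \<alpha> = steps \<beta>" "hd \<alpha> = hd \<beta>" "last \<alpha> = last \<beta>" "distinct_adj \<alpha> = distinct_adj \<beta>"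
    "length \<alpha> = length \<beta>"
  using assms by (induction; simp add: seq_step_invariants)+

lemma seq_eq_Cons:
  assumes "seq_eq \<alpha> \<beta>"
  shows "seq_eq (x # \<alpha>) (x # \<beta>)"
  using assms
proof induction
  case (step \<beta> \<gamma>)
  from step.hyps(2) have "seq_step (x # \<beta>) (x # \<gamma>)"
    by cases (metis append_Cons seq_step.intros)
  with step.IH show ?case by (rule rtranclp.rtrancl_into_rtrancl)
qed simp

text \<open>
  An occurrence of the label \<open>d\<close> moves to the front by repeatedly exchanging it with the label before
  it. If that label is different, the three entries involved are distinct, so the exchange is a
  legitimate replacement of the middle entry by the fourth index.
\<close>

lemma seq_eq_step_first:
  assumes "distinct_adj \<alpha>" "d \<in># steps \<alpha>"
  shows "\<exists>x y \<beta>. seq_eq \<alpha> (x # y # \<beta>) \<and> pairing x y = d"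
  using assms
proof (induction \<alpha> rule: steps.induct)
  case (1 x y \<alpha>)
  show ?case
  proof (cases "pairing x y = d")
    case False
    with 1 obtain y' z \<beta> where eq: "seq_eq (y # \<alpha>) (y' # z # \<beta>)" and z: "pairing y' z = d"
      by auto
    have y': "y' = y" and adj: "distinct_adj (y # z # \<beta>)"
      using seq_eq_invariants[OF eq] 1(2) by auto
    with 1(2) False z have "distinct [x, y, z]"
      by (auto simp: pairing_commute)
    then obtain w where w: "distinct [x, y, z, w]"
      by (rule ex_fourth_index)
    then have "seq_step ([] @ [x, y, z] @ \<beta>) ([] @ [x, w, z] @ \<beta>)"
      by (intro seq_step.intros) auto
    with seq_eq_Cons[OF eq, of x] y' have "seq_eq (x # y # \<alpha>) (x # w # z # \<beta>)"
      by simp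
    moreover have "pairing x w = d"
      using w z y' pairing_opposite[of x w y z] by auto
    ultimately show ?thesis by blast
  qed blast
qed auto

text \<open>
  As labels commute, the multiset of labels together with the start is a complete invariant: move the
  first label of \<open>\<beta>\<close> to the front of \<open>\<alpha>\<close> and compare the remainders.
\<close>

lemma seq_eq_if_same_steps:
  assumes "distinct_adj \<alpha>" "distinct_adj \<beta>" "\<alpha> \<noteq> []" "\<beta> \<noteq> []"
    and "last \<alpha> = last \<beta>" "steps \<alpha> = steps \<beta>"
  shows "seq_eq \<alpha> \<beta>"
  using assms
proof (induction \<beta> arbitrary: \<alpha> rule: steps.induct)
  case (1 x y \<beta>)
  obtain x' y' \<gamma> where eq: "seq_eq \<alpha> (x' # y' # \<gamma>)" and p: "pairing x' y' = pairing x y"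
    using seq_eq_step_first[of \<alpha> "pairing x y"] 1 by auto
  have "distinct_adj (x' # y' # \<gamma>)" "last (x' # y' # \<gamma>) = last (x # y # \<beta>)"
      "steps (x' # y' # \<gamma>) = steps (x # y # \<beta>)"
    using seq_eq_invariants[OF eq] 1 by metis+
  then have rest: "seq_eq (y' # \<gamma>) (y # \<beta>)"
    using 1 p by (intro 1(1)) auto
  \<comment> \<open>Identified sequences have equal ends, and the pairing then determines the entry before.\<close>
  have "y' = y"
    using seq_eq_invariants(2)[OF rest] by simp
  with p have "x' = x"
    by (metis pairing_commute pairing_eq_iff)
  with eq seq_eq_Cons[OF rest, of x'] show ?case
    by simp
next
  case ("2_2" x)
  then show ?case by (cases \<alpha> rule: steps.cases) auto
qed auto

section \<open>The admissible elements in closed form\<close>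

lemma gen_atom_swap:
  assumes "distinct [i, j, k]"
  shows "gen i \<sqinter> atom j k n = gen i \<sqinter> atom k j n"
proof -
  obtain l where "distinct [i, j, k, l]"
    using assms by (rule ex_fourth_index)
  then show ?thesis
    by (intro atom_swap[of l]) auto
qed

text \<open>
  The argument \<open>f m\<close> is the index of the atomic element for the two indices other than \<open>i\<close> and \<open>m\<close>,
  that is, for the block avoiding \<open>i\<close> of the pairing of \<open>i\<close> and \<open>m\<close>. The upper indices are listed in
  one fixed order; in the meet with \<open>gen i\<close> their order does not matter.
\<close>

definition gen_meet :: "index \<Rightarrow> (index \<Rightarrow> nat) \<Rightarrow> D4" where
  "gen_meet i f = (case filter (\<lambda>m. m \<noteq> i) [N1, N2, N3, N4] of
     [j, k, l] \<Rightarrow> gen i \<sqinter> atom k l (f j) \<sqinter> atom j l (f k) \<sqinter> atom j k (f l) | _ \<Rightarrow> undefined)"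

lemma gen_meet_eq:
  assumes "distinct [i, j, k, l]"
  shows "gen_meet i f = gen i \<sqinter> atom k l (f j) \<sqinter> atom j l (f k) \<sqinter> atom j k (f l)"
proof -
  define g where "g i m n p = gen i \<sqinter> atom m n p" for i m n p
  have split: "gen i \<sqinter> atom k l p \<sqinter> atom j l q \<sqinter> atom j k r = g i k l p \<sqinter> g i j l q \<sqinter> g i j k r"
    for i j k l p q r
    by (simp add: g_def ac_simps)
  have g: "g i m n p = g i n m p" if "distinct [i, m, n]" for i m n p
    using gen_atom_swap[OF that] by (simp add: g_def)
  show ?thesis
    using assms
    by (cases i; cases j; cases k; cases l)
      (simp_all add: gen_meet_def split, simp_all add: g ac_simps)
qed

definition class_elem :: "index list \<Rightarrow> D4" where
  "class_elem \<alpha> = gen_meet (hd \<alpha>) (\<lambda>m. count (steps \<alpha>) (pairing (hd \<alpha>) m))"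

text \<open>
  This form allows each atomic factor its upper indices in either order, as they occur in the eight
  expressions for the admissible elements.
\<close>

lemma gen_meet_eqI:
  assumes "distinct [i, j, k, l]" "{u, v} = {k, l}" "{u', v'} = {j, l}" "{u'', v''} = {j, k}"
    and "f j = p" "f k = q" "f l = r"
  shows "gen i \<sqinter> atom u v p \<sqinter> atom u' v' q \<sqinter> atom u'' v'' r = gen_meet i f"
proof -
  have split: "gen i \<sqinter> x \<sqinter> y \<sqinter> z = (gen i \<sqinter> x) \<sqinter> (gen i \<sqinter> y) \<sqinter> (gen i \<sqinter> z)" for x y z
    by (simp add: ac_simps)
  have swap: "gen i \<sqinter> atom u v p = gen i \<sqinter> atom k l p" "gen i \<sqinter> atom u' v' q = gen i \<sqinter> atom j l q"
    "gen i \<sqinter> atom u'' v'' r = gen i \<sqinter> atom j k r"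
    using assms(1-4) by (auto simp: doubleton_eq_iff intro: gen_atom_swap)
  have "gen i \<sqinter> atom u v p \<sqinter> atom u' v' q \<sqinter> atom u'' v'' r =
      gen i \<sqinter> atom k l p \<sqinter> atom j l q \<sqinter> atom j k r"
    by (subst (1 2) split) (simp only: swap)
  then show ?thesis
    unfolding gen_meet_eq[OF assms(1)] assms(5-7) .
qed

lemma steps_rep: "steps (a # rep [b, a] t @ \<beta>) = replicate_mset (2 * t) (pairing a b) + steps (a # \<beta>)"
  by (induction t) (simp_all add: pairing_commute)

lemma distinct_adj_rep:
  "a \<noteq> b \<Longrightarrow> distinct_adj (a # rep [b, a] t @ \<beta>) \<longleftrightarrow> distinct_adj (a # \<beta>)"
  by (induction t) auto

lemma last_rep: "last (a # rep [b, a] t @ \<beta>) = last (a # \<beta>)"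
  by (induction t) auto

lemmas rep_simps =
  steps_rep steps_rep[where \<beta> = "[]", unfolded append_Nil2]
  distinct_adj_rep distinct_adj_rep[where \<beta> = "[]", unfolded append_Nil2]
  last_rep last_rep[where \<beta> = "[]", unfolded append_Nil2]

text \<open>
  The eight listed expressions agree with the closed form: in each line the counts of the three labels
  along the listed sequence are the lower indices of the three atomic elements. The substitution \<open>\<sigma>\<close>
  is carried along by letting \<open>a, b, c, d\<close> stand for the images of 1, 2, 3, 4.
\<close>

lemma adm_form_class_elem:
  assumes "adm_form \<sigma> \<beta> x" "inj \<sigma>"
  shows "x = class_elem (map \<sigma> \<beta>)"
proof -
  define a b c d where "a = \<sigma> N1" "b = \<sigma> N2" "c = \<sigma> N3" "d = \<sigma> N4"
  note \<sigma> = this[symmetric]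
  have D: "distinct [a, b, c, d]"
    using \<open>inj \<sigma>\<close> by (auto simp: a_b_c_d_def inj_eq)
  then have neq: "a \<noteq> b" "a \<noteq> c" "a \<noteq> d" "b \<noteq> c" "b \<noteq> d" "c \<noteq> d"
    by auto
  \<comment> \<open>All pairings are written with \<open>a\<close> as first index, so that they can be compared syntactically.\<close>
  have P: "pairing b a = pairing a b" "pairing c a = pairing a c" "pairing d a = pairing a d"
    "pairing c d = pairing a b" "pairing d c = pairing a b" "pairing b d = pairing a c"
    "pairing d b = pairing a c" "pairing b c = pairing a d" "pairing c b = pairing a d"
    using D pairing_opposite[of a b c d] pairing_opposite[of a c b d] pairing_opposite[of a d b c]
    by (auto simp: pairing_commute)
  \<comment> \<open>In each line the four indices handed to \<open>gen_meet_eqI\<close> are the end and then, for the three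
    atomic factors from left to right, the index that is neither the end nor an upper index of
    the factor.\<close>
  note S = class_elem_def map_concat \<sigma> rep_simps P neq neq[symmetric]
  show ?thesis
    using assms(1)
  proof cases
    case (1 t r s)
    then obtain t' where "t = Suc t'" by (cases t) auto
    with 1 show ?thesis by (simp add: S del: atomic.simps)
        (rule gen_meet_eqI[of b d c a]; use neq in \<open>auto simp: P\<close>)
  next
    case (2 s r t)
    then obtain s' where "s = Suc s'" by (cases s) auto
    with 2 show ?thesis by (simp add: S del: atomic.simps)
        (rule gen_meet_eqI[of c d b a]; use neq in \<open>auto simp: P\<close>)
  next
    case (3 r s t)
    then obtain r' where "r = Suc r'" by (cases r) auto
    with 3 show ?thesis by (simp add: S del: atomic.simps)
        (rule gen_meet_eqI[of d c b a]; use neq in \<open>auto simp: P\<close>)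
  next
    case (4 r s t)
    then show ?thesis by (simp add: S del: atomic.simps)
        (rule gen_meet_eqI[of a c b d]; use neq in \<open>auto simp: P\<close>)
  next
    case (5 r t s)
    then obtain r' where "r = Suc r'" by (cases r) auto
    with 5 show ?thesis by (simp add: S del: atomic.simps)
        (rule gen_meet_eqI[of b a d c]; use neq in \<open>auto simp: P\<close>)
  next
    case (6 r t s)
    then obtain r' where "r = Suc r'" by (cases r) auto
    with 6 show ?thesis by (simp add: S del: atomic.simps)
        (rule gen_meet_eqI[of c a d b]; use neq in \<open>auto simp: P\<close>)
  next
    case (7 t s r)
    then obtain t' where "t = Suc t'" by (cases t) auto
    with 7 show ?thesis by (simp add: S del: atomic.simps)
        (rule gen_meet_eqI[of d a b c]; use neq in \<open>auto simp: P\<close>)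
  next
    case (8 r s t)
    then obtain r' s' where "r = Suc r'" "s = Suc s'" by (cases r; cases s) auto
    with 8 show ?thesis by (simp add: S del: atomic.simps)
        (rule gen_meet_eqI[of a d c b]; use neq in \<open>auto simp: P\<close>)
  qed
qed

text \<open>
  The eight lines correspond to the eight parity patterns of the three counts, so every triple of
  counts is realized by a listed sequence. A repetition \<open>(21)\<^sup>t\<close> contributes \<open>2t\<close> labels
  of its own pairing if it follows an entry 1, and otherwise only \<open>2t - 1\<close>; an odd count therefore
  comes from a repetition of the second kind or from the transition into one.
\<close>

lemma ex_adm_form:
  "\<exists>\<beta> x. adm_form \<sigma> \<beta> x \<and> \<beta> \<noteq> [] \<and> distinct_adj \<beta> \<and> last \<beta> = N1 \<and>
    steps \<beta> = replicate_mset p (pairing N1 N2) + replicate_mset q (pairing N1 N3)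
      + replicate_mset r (pairing N1 N4)"
proof -
  have P: "pairing N2 N1 = pairing N1 N2" "pairing N3 N1 = pairing N1 N3"
    "pairing N4 N1 = pairing N1 N4" "pairing N3 N4 = pairing N1 N2" "pairing N4 N3 = pairing N1 N2"
    "pairing N2 N4 = pairing N1 N3" "pairing N4 N2 = pairing N1 N3" "pairing N2 N3 = pairing N1 N4"
    "pairing N3 N2 = pairing N1 N4"
    using pairing_opposite[of N1 N2 N3 N4] pairing_opposite[of N1 N3 N2 N4]
      pairing_opposite[of N1 N4 N2 N3]
    by (auto simp: pairing_commute)
  have last: "last [x] = x" "last (x # y # \<beta>) = last (y # \<beta>)" for x y :: index and \<beta>
    by simp_all
  have parity: "(\<exists>m. n = 2 * m) \<or> (\<exists>m. n = Suc (2 * m))" for n :: nat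
    by presburger
  note S = rep_simps last P
  consider
      t s u where "p = 2 * t" "q = 2 * s" "r = 2 * u"
    | t s u where "p = Suc (2 * t)" "q = 2 * s" "r = 2 * u"
    | t s u where "p = 2 * t" "q = Suc (2 * s)" "r = 2 * u"
    | t s u where "p = 2 * t" "q = 2 * s" "r = Suc (2 * u)"
    | t s u where "p = 2 * t" "q = Suc (2 * s)" "r = Suc (2 * u)"
    | t s u where "p = Suc (2 * t)" "q = 2 * s" "r = Suc (2 * u)"
    | t s u where "p = Suc (2 * t)" "q = Suc (2 * s)" "r = 2 * u"
    | t s u where "p = Suc (2 * t)" "q = Suc (2 * s)" "r = Suc (2 * u)"
    using parity[of p] parity[of q] parity[of r] by (elim disjE exE; metis)
  then show ?thesis
  proof cases
    case (1 t s u)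
    then show ?thesis
      by (intro exI conjI, rule_tac adm_form.intros(4)[of \<sigma> u s t]) (simp_all add: S del: last.simps)
  next
    case (2 t s u)
    then show ?thesis
      by (intro exI conjI, rule_tac adm_form.intros(1)[of "Suc t" \<sigma> u s]) (simp_all add: S del: last.simps)
  next
    case (3 t s u)
    then show ?thesis
      by (intro exI conjI, rule_tac adm_form.intros(2)[of "Suc s" \<sigma> u t]) (simp_all add: S del: last.simps)
  next
    case (4 t s u)
    then show ?thesis
      by (intro exI conjI, rule_tac adm_form.intros(3)[of "Suc u" \<sigma> s t]) (simp_all add: S del: last.simps)
  next
    case (5 t s u)
    then show ?thesis
      by (intro exI conjI, rule_tac adm_form.intros(5)[of "Suc u" \<sigma> s t]) (simp_all add: S del: last.simps)
  next
    case (6 t s u)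
    then show ?thesis
      by (intro exI conjI, rule_tac adm_form.intros(6)[of "Suc u" \<sigma> t s]) (simp_all add: S del: last.simps)
  next
    case (7 t s u)
    then show ?thesis
      by (intro exI conjI, rule_tac adm_form.intros(7)[of "Suc t" \<sigma> s u]) (simp_all add: S del: last.simps)
  next
    case (8 t s u)
    then show ?thesis
      by (intro exI conjI, rule_tac adm_form.intros(8)[of "Suc u" "Suc s" \<sigma> t]) (simp_all add: S del: last.simps)
  qed
qed

lemma steps_replicate:
  assumes "distinct_adj \<alpha>"
  shows "\<exists>p q r. steps \<alpha> = replicate_mset p (pairing N1 N2) + replicate_mset q (pairing N1 N3)
      + replicate_mset r (pairing N1 N4)"
  using assms
proof (induction \<alpha> rule: steps.induct)
  case (1 x y \<alpha>)
  then obtain p q r where IH: "steps (y # \<alpha>) = replicate_mset p (pairing N1 N2)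
      + replicate_mset q (pairing N1 N3) + replicate_mset r (pairing N1 N4)"
    by auto
  obtain n where n: "n \<noteq> N1" "pairing x y = pairing N1 n"
    using 1(2) by (auto intro: pairing_partner[of x y N1])
  have "steps (x # y # \<alpha>) = add_mset (pairing N1 n) (replicate_mset p (pairing N1 N2)
      + replicate_mset q (pairing N1 N3) + replicate_mset r (pairing N1 N4))"
    by (simp add: IH n)
  with n(1) show ?case
    by (cases n)
      (metis replicate_mset_Suc union_mset_add_mset_left union_mset_add_mset_right)+
qed (auto intro: exI[of _ 0])

text \<open>
  Some listed sequence is identified with the relabelled \<open>\<alpha>\<close>, as its label counts can be prescribed;
  and the value attached to any such sequence is the closed form, which depends on the end and on the
  labels only. Undoing the interchange \<open>\<tau>\<close> on the listed sequence gives back the end and the labels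
  of \<open>\<alpha>\<close> itself, since \<open>\<tau>\<close> is an involution.
\<close>

theorem adm_elem_eq_class_elem:
  assumes "admissible \<alpha>"
  shows "adm_elem \<alpha> = class_elem \<alpha>"
proof -
  define \<tau> where "\<tau> = Transposition.transpose N1 (last \<alpha>)"
  have \<tau>: "bij \<tau>" "\<tau> (\<tau> i) = i" for i
    by (simp_all add: \<tau>_def)
  then have "inj \<tau>"
    by (simp add: bij_is_inj)
  have \<alpha>: "\<alpha> \<noteq> []" "distinct_adj \<alpha>"
    using assms by (auto simp: admissible_def)
  have adj: "distinct_adj (map \<tau> \<alpha>)"
    using \<alpha> \<open>inj \<tau>\<close> by (simp add: distinct_adj_map_iff inj_on_subset)
  have last: "last (map \<tau> \<alpha>) = N1"
    using \<alpha> by (simp add: last_map \<tau>_def)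
  obtain \<beta> x where \<beta>: "adm_form \<tau> \<beta> x" "\<beta> \<noteq> []" "distinct_adj \<beta>" "last \<beta> = N1"
    "steps \<beta> = steps (map \<tau> \<alpha>)"
    using steps_replicate[OF adj] ex_adm_form[of \<tau>] by metis
  have "seq_eq (map \<tau> \<alpha>) \<beta>"
    using \<beta> \<alpha> adj last by (intro seq_eq_if_same_steps) auto
  moreover have "x = class_elem \<alpha>" if form: "adm_form \<tau> \<beta> x" and eq: "seq_eq (map \<tau> \<alpha>) \<beta>" for \<beta> x
  proof -
    have "map \<tau> (map \<tau> \<alpha>) = \<alpha>"
      by (simp add: \<tau> comp_def)
    then have "steps (map \<tau> \<beta>) = steps \<alpha>"
      using seq_eq_invariants(1)[OF eq] steps_map[OF \<tau>(1)] by metis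
    moreover have "\<beta> \<noteq> []"
      using seq_eq_invariants(5)[OF eq] \<alpha> by auto
    then have "hd (map \<tau> \<beta>) = hd \<alpha>"
      using seq_eq_invariants(2)[OF eq] \<alpha> \<tau>(2) by (simp add: hd_map flip: \<open>hd (map \<tau> \<alpha>) = hd \<beta>\<close>)
    ultimately have "class_elem (map \<tau> \<beta>) = class_elem \<alpha>"
      by (simp add: class_elem_def)
    with adm_form_class_elem[OF form \<open>inj \<tau>\<close>] show ?thesis
      by simp
  qed
  ultimately show ?thesis
    unfolding adm_elem_def Let_def \<tau>_def[symmetric]
    using \<beta>(1) by (intro the_equality) blast+
qed

section \<open>The action of Herrmann's endomorphisms\<close>

context modular_lattice
begin

lemma modular_law': "x \<le> z \<Longrightarrow> z \<sqinter> (x \<squnion> y) = x \<squnion> y \<sqinter> z"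
  by (metis modular_law inf_commute)

text \<open>
  Two computations with the modular law evaluate the meet of \<open>q = (a + b)(c + d)\<close> with an atomic
  element. They are the recursion steps for Herrmann's endomorphism \<open>\<gamma>\<close>: the image of an atomic
  element \<open>x + yz\<close> is \<open>xq + yq\<gamma>(z)\<close>, and inserting \<open>qw\<close> or \<open>qv\<close> for \<open>\<gamma>(z)\<close> gives the right-hand
  sides.
\<close>

lemma restrict_across:
  assumes "q = (a \<squnion> b) \<sqinter> (c \<squnion> d)"
  shows "q \<sqinter> (a \<squnion> c \<sqinter> w) = a \<sqinter> q \<squnion> c \<sqinter> q \<sqinter> (q \<sqinter> w)"
proof -
  have "q \<sqinter> (a \<squnion> c \<sqinter> w) = (a \<squnion> b) \<sqinter> ((c \<squnion> d) \<sqinter> (c \<sqinter> w \<squnion> a))"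
    by (simp add: assms inf_assoc sup_commute)
  also have "\<dots> = (a \<squnion> b) \<sqinter> (a \<sqinter> (c \<squnion> d) \<squnion> c \<sqinter> w)"
    by (subst modular_law') (auto simp: le_infI1 sup_commute)
  also have "\<dots> = a \<sqinter> (c \<squnion> d) \<squnion> c \<sqinter> w \<sqinter> (a \<squnion> b)"
    by (rule modular_law') (simp add: le_infI1)
  also have "a \<sqinter> (c \<squnion> d) = a \<sqinter> q"
    by (simp add: assms flip: inf_assoc)
  also have "c \<sqinter> w \<sqinter> (a \<squnion> b) = c \<sqinter> q \<sqinter> (q \<sqinter> w)"
  proof -
    have "c \<sqinter> q \<sqinter> (q \<sqinter> w) = (a \<squnion> b) \<sqinter> (c \<sqinter> (c \<squnion> d)) \<sqinter> w"
      unfolding assms by (simp only: inf_assoc inf_commute inf_left_commute inf_left_idem inf_idem)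
    also have "\<dots> = c \<sqinter> w \<sqinter> (a \<squnion> b)"
      by (simp only: inf_sup_absorb inf_assoc inf_commute inf_left_commute)
    finally show ?thesis ..
  qed
  finally show ?thesis .
qed

lemma restrict_along:
  assumes "q = (a \<squnion> b) \<sqinter> (c \<squnion> d)" "v \<le> a \<squnion> b"
  shows "q \<sqinter> (c \<squnion> d \<sqinter> v) = c \<sqinter> q \<squnion> d \<sqinter> q \<sqinter> (q \<sqinter> v)"
proof -
  have le: "d \<sqinter> v \<le> q"
    using assms by (simp add: le_infI1 le_infI2 le_supI2)
  have "q \<sqinter> (d \<sqinter> v \<squnion> c) = d \<sqinter> v \<squnion> c \<sqinter> q"
    using le by (rule modular_law')
  moreover have "d \<sqinter> v = d \<sqinter> q \<sqinter> (q \<sqinter> v)"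
  proof -
    have "d \<sqinter> v = d \<sqinter> v \<sqinter> q"
      using le by (rule inf_absorb1[symmetric])
    also have "\<dots> = d \<sqinter> q \<sqinter> (q \<sqinter> v)"
      by (simp only: inf_assoc inf_commute inf_left_commute inf_left_idem)
    finally show ?thesis .
  qed
  ultimately show ?thesis
    by (simp add: sup_commute)
qed

end

lemma herrmann_hom:
  "herrmann i j (x \<squnion> y) = herrmann i j x \<squnion> herrmann i j y"
  "herrmann i j (x \<sqinter> y) = herrmann i j x \<sqinter> herrmann i j y"
  using herrmann(1)[of i j] unfolding lattice_hom_def by blast+

lemma herrmann_eq_if_pairing_eq:
  assumes "i \<noteq> j" "pairing i j = pairing k l"
  shows "herrmann i j = herrmann k l"
proof -
  obtain m n where mn: "distinct [i, j, m, n]"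
    using assms(1) by (rule ex_complementary_pair)
  have "{k, l} \<in> pairing i j"
    unfolding assms(2) by (simp add: pairing_def)
  then have "{k, l} = {i, j} \<or> {k, l} = {m, n}"
    by (simp add: pairing_def Compl_index[OF mn])
  then consider "k = i" "l = j" | "k = j" "l = i" | "k = m" "l = n" | "k = n" "l = m"
    by (auto simp: doubleton_eq_iff)
  then have "q_elem i j = q_elem k l"
  proof cases
    case 2
    then show ?thesis
      using mn q_elem_eq[of i j m n] q_elem_eq[of j i m n] by (auto simp: sup_commute)
  next
    case 3
    then show ?thesis
      using mn q_elem_eq[of i j m n] q_elem_eq[of m n i j] by (auto simp: inf_commute)
  next
    case 4
    then show ?thesis
      using mn q_elem_eq[of i j m n] q_elem_eq[of n m i j] by (auto simp: inf_commute sup_commute)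
  qed simp
  then show ?thesis
    by (simp add: herrmann_def)
qed

lemma herrmann_commute: "herrmann i j = herrmann j i"
  by (cases "i = j") (auto intro: herrmann_eq_if_pairing_eq simp: pairing_commute)

lemma herrmann_opposite: "distinct [i, j, k, l] \<Longrightarrow> herrmann i j = herrmann k l"
  by (rule herrmann_eq_if_pairing_eq[OF _ pairing_opposite]) auto

lemma atom_Suc_le: "atom i j (Suc n) \<le> gen i \<squnion> gen j"
  by (simp add: le_supI2 le_infI1 split: prod.split)

text \<open>
  The recursion for \<open>a\<^sup>i\<^sup>k\<close> calls \<open>a\<^sup>j\<^sup>l\<close>, which again joins the two blocks of the pairing, so that the
  claim passes from one to the other with \<open>i\<close> and \<open>j\<close> exchanged.
\<close>

lemma herrmann_atom_across:
  assumes "distinct [i, j, k, l]"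
  shows "herrmann i j (atom i k n) = q_elem i j \<sqinter> atom i k n"
  using assms
proof (induction n arbitrary: i j k l)
  case 0
  show ?case by (simp add: herrmann(2))
next
  case (Suc n)
  have q: "q_elem j i = q_elem i j"
    using Suc.prems herrmann(2) herrmann_commute by metis
  have "herrmann i j (atom j l n) = q_elem i j \<sqinter> atom j l n"
    using Suc.IH[of j i l k] Suc.prems by (auto simp: herrmann_commute[of j i] q)
  moreover have "atom i k (Suc n) = gen i \<squnion> gen k \<sqinter> atom j l n"
    using Suc.prems by (intro atom_Suc) auto
  ultimately show ?case
    using restrict_across[OF q_elem_eq[OF Suc.prems], of "atom j l n"]
    by (simp only: herrmann_hom herrmann(4))
qed

text \<open>
  The index shift comes from the start of the recursion: the image of \<open>I\<close> is \<open>q\<close>, which equals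
  \<open>q(e\<^sub>k + e\<^sub>l)\<close>, that is \<open>q a\<^sup>k\<^sup>l\<^sub>1\<close>. The recursion alternates between the two blocks \<open>{i, j}\<close> and
  \<open>{k, l}\<close> of the pairing, which give the same endomorphism.
\<close>

lemma herrmann_atom_along:
  assumes "distinct [i, j, k, l]"
  shows "herrmann i j (atom k l n) = q_elem i j \<sqinter> atom k l (Suc n)"
  using assms
proof (induction n arbitrary: i j k l)
  case 0
  have "atom k l (Suc 0) = gen k \<squnion> gen l"
    using atom_Suc[of k l i j 0] 0 by simp
  then show ?case
    by (simp add: herrmann(2) q_elem_eq[OF 0] inf_assoc del: atomic.simps(2))
next
  case (Suc n)
  have q: "q_elem k l = q_elem i j"
    using Suc.prems herrmann(2) herrmann_opposite by metis
  have IH: "herrmann i j (atom i j n) = q_elem i j \<sqinter> atom i j (Suc n)"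
    using Suc.IH[of k l i j] Suc.prems herrmann_opposite[OF Suc.prems] by (auto simp: q)
  have rec: "atom k l (Suc m) = gen k \<squnion> gen l \<sqinter> atom i j m" for m
    using Suc.prems by (intro atom_Suc) auto
  from restrict_along[OF q_elem_eq[OF Suc.prems] atom_Suc_le] show ?case
    by (simp only: rec[of n] rec[of "Suc n"] herrmann_hom herrmann(4) IH)
qed

text \<open>
  The factors \<open>q\<close> disappear because \<open>e\<^sub>i \<le> e\<^sub>i + e\<^sub>j\<close> and \<open>a\<^sup>k\<^sup>l\<^sub>n\<^sub>+\<^sub>1 \<le> e\<^sub>k + e\<^sub>l\<close>; the second bound is
  available for \<open>n = 0\<close> too, thanks to the raised index.
\<close>

lemma herrmann_gen_meet:
  assumes "i \<noteq> j"
  shows "herrmann i j (gen_meet i f) = gen_meet i (f(j := Suc (f j)))"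
proof -
  obtain k l where d: "distinct [i, j, k, l]"
    using assms by (rule ex_complementary_pair)
  define q A B C where "q = q_elem i j" and "A = atom k l (Suc (f j))"
    and "B = atom j l (f k)" and "C = atom j k (f l)"
  have "herrmann i j (atom k l (f j)) = q \<sqinter> A"
    using herrmann_atom_along[OF d] by (simp only: q_def A_def)
  moreover have "q_elem j i = q"
    unfolding q_def by (metis herrmann(2) herrmann_commute)
  then have "herrmann i j B = q \<sqinter> B" "herrmann i j C = q \<sqinter> C"
    using d herrmann_atom_across[of j i l k "f k"] herrmann_atom_across[of j i k l "f l"]
    by (auto simp: herrmann_commute[of j i] B_def C_def)
  ultimately have "herrmann i j (gen_meet i f) = gen i \<sqinter> q \<sqinter> (q \<sqinter> A) \<sqinter> (q \<sqinter> B) \<sqinter> (q \<sqinter> C)"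
    by (simp add: gen_meet_eq[OF d] herrmann_hom herrmann(4) q_def B_def C_def)
  also have "\<dots> = gen i \<sqinter> A \<sqinter> q \<sqinter> B \<sqinter> C"
    by (simp add: ac_simps)
  also have "A \<le> gen k \<squnion> gen l"
    unfolding A_def by (rule atom_Suc_le)
  then have "gen i \<sqinter> A \<le> q"
    by (simp add: q_def q_elem_eq[OF d] le_infI1 le_infI2)
  then have "gen i \<sqinter> A \<sqinter> q = gen i \<sqinter> A"
    by (rule inf_absorb1)
  also have "gen i \<sqinter> A \<sqinter> B \<sqinter> C = gen_meet i (f(j := Suc (f j)))"
  proof -
    have "k \<noteq> j" "l \<noteq> j"
      using d by auto
    then show ?thesis
      by (simp only: gen_meet_eq[OF d] A_def B_def C_def fun_upd_same fun_upd_other not_False_eq_True)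
  qed
  finally show ?thesis .
qed

theorem theorem3p4:
  fixes i k :: index and \<alpha> :: "index list"
  assumes "i \<noteq> k"
    and "admissible \<alpha>"
    and "admissible (\<alpha> @ [k])"
  shows "herrmann i k (adm_elem (\<alpha> @ [k])) = adm_elem (\<alpha> @ [k, i])"
proof -
  define e where "e = hd \<alpha>"
  have \<alpha>: "\<alpha> \<noteq> []" and adj: "distinct_adj (\<alpha> @ [k])"
    using assms by (auto simp: admissible_def)
  have adm: "admissible (\<alpha> @ [k, i])"
    using \<alpha> adj assms(1) by (auto simp: admissible_def distinct_adj_append_iff)
  obtain j where j: "j \<noteq> e" "pairing k i = pairing e j"
    using assms(1) by (auto intro: pairing_partner[of k i e])
  have steps: "steps (\<alpha> @ [k, i]) = add_mset (pairing e j) (steps (\<alpha> @ [k]))"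
    using steps_append[of \<alpha> k "[i]"] by (simp add: j)
  \<comment> \<open>The pairing of \<open>i\<close> and \<open>k\<close> is rewritten with the end \<open>e\<close> of the sequence as one of its indices.\<close>
  have "herrmann i k = herrmann e j"
    using assms(1) j by (intro herrmann_eq_if_pairing_eq) (auto simp: pairing_commute)
  then have "herrmann i k (adm_elem (\<alpha> @ [k])) =
      gen_meet e ((\<lambda>m. count (steps (\<alpha> @ [k])) (pairing e m))(j := Suc (count (steps (\<alpha> @ [k])) (pairing e j))))"
    using j assms(3) \<alpha> by (simp add: adm_elem_eq_class_elem class_elem_def herrmann_gen_meet flip: e_def)
  also have "(\<lambda>m. count (steps (\<alpha> @ [k])) (pairing e m))(j := Suc (count (steps (\<alpha> @ [k])) (pairing e j)))
      = (\<lambda>m. count (steps (\<alpha> @ [k, i])) (pairing e m))"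
    by (auto simp: steps fun_eq_iff)
  also have "gen_meet e \<dots> = adm_elem (\<alpha> @ [k, i])"
    using \<alpha> by (simp add: adm_elem_eq_class_elem[OF adm] class_elem_def e_def)
  finally show ?thesis .
qed

end
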